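(* Let $f\in C^2(\mathbb{R})$ with $f''\ge0$ and $\mathcal{L}\{u:f''(u)=0\}=0$, let $\varphi\in L^\infty(\mathbb{R})$, and set $$\overline u_l=\limsup_{x\to-\infty}\frac1x\int_0^x\varphi\,d\xi,\quad\underline u_l=\liminf_{x\to-\infty}\frac1x\int_0^x\varphi\,d\xi,\quad\overline u_r=\limsup_{x\to\infty}\frac1x\int_0^x\varphi\,d\xi,\quad\underline u_r=\liminf_{x\to\infty}\frac1x\int_0^x\varphi\,d\xi.$$ Let $u=u(x,t)$ be the entropy solution of the Cauchy problem $u_t+f(u)_x=0$ on $\mathbb{R}\times(0,\infty)$, $u|_{t=0}=\varphi$. Then, for any $t>0$, $$\limsup_{x\to-\infty}\frac1x\int_0^xu(\xi,t)\,d\xi=\overline u_l,\qquad\liminf_{x\to-\infty}\frac1x\int_0^xu(\xi,t)\,d\xi=\underline u_l,$$ $$\limsup_{x\to\infty}\frac1x\int_0^xu(\xi,t)\,d\xi=\overline u_r,\qquad\liminf_{x\to\infty}\frac1x\int_0^xu(\xi,t)\,d\xi=\underline u_r.$$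
   Context: The entropy solution is given for $t>0$ by $u(x,t)=\inf\mathcal{U}(x,t)$, where $\mathcal{U}(x,t)$ is the (nonempty compact) set of maximizers over $\mathbb{R}$ of $E(u;x,t)=t\int_0^u f''(s)(\varphi(x-tf'(s))-s)\,ds$. It is the unique bounded weak solution (with $\lim_{t\to0+}\int_{x_1}^{x_2}u(x,t)\,dx=\int_{x_1}^{x_2}\varphi\,dx$ for all $x_1,x_2$) satisfying $f'(u(x_2,t))-f'(u(x_1,t))\le(x_2-x_1)/t$ for all $x_2>x_1$, $t>0$. $\mathcal{L}$ is Lebesgue measure. *)

theory Defs
  imports "HOL-Analysis.Analysis"
begin

definition C2 :: "(real \<Rightarrow> real) \<Rightarrow> bool" where
  "C2 f \<longleftrightarrow>
     (\<forall>v. f differentiable (at v)) \<and>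
     (\<forall>v. deriv f differentiable (at v)) \<and>
     continuous_on UNIV (deriv (deriv f))"

definition L_infinity :: "(real \<Rightarrow> real) \<Rightarrow> bool" where
  "L_infinity \<phi> \<longleftrightarrow>
     \<phi> \<in> borel_measurable lebesgue \<and> (\<exists>C. AE x in lebesgue. \<bar>\<phi> x\<bar> \<le> C)"

text \<open>All integrals are taken with respect to \<^const>\<open>lebesgue\<close> rather than
  \<^const>\<open>lborel\<close>: the initial datum is only Lebesgue measurable, and the Bochner integral over
  \<^const>\<open>lborel\<close> of a function that is not Borel measurable is 0. The interval integral is
  oriented, i.e. it changes sign when its limits are exchanged.\<close>

definition E_fun :: "(real \<Rightarrow> real) \<Rightarrow> (real \<Rightarrow> real) \<Rightarrow> real \<Rightarrow> real \<Rightarrow> real \<Rightarrow> real" where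
  "E_fun f \<phi> x t v =
     t * (LINT s=0..v|lebesgue. (deriv (deriv f) s * (\<phi> (x - t * deriv f s) - s)))"

definition maximizers :: "(real \<Rightarrow> real) \<Rightarrow> (real \<Rightarrow> real) \<Rightarrow> real \<Rightarrow> real \<Rightarrow> real set" where
  "maximizers f \<phi> x t = {v. \<forall>w. E_fun f \<phi> x t w \<le> E_fun f \<phi> x t v}"

text \<open>\<open>\<psi>\<close> is a \<open>C\<^sup>1\<close> function with compact support in the open upper half-plane;
  \<open>\<psi>x\<close> and \<open>\<psi>t\<close> are its partial derivatives. Points of the plane are pairs \<open>(x, t)\<close>.\<close>

definition test_function ::
  "(real \<times> real \<Rightarrow> real) \<Rightarrow> (real \<times> real \<Rightarrow> real) \<Rightarrow> (real \<times> real \<Rightarrow> real) \<Rightarrow> bool" where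
  "test_function \<psi> \<psi>x \<psi>t \<longleftrightarrow>
     (\<forall>p. (\<psi> has_derivative (\<lambda>(h, k). \<psi>x p * h + \<psi>t p * k)) (at p)) \<and>
     continuous_on UNIV \<psi>x \<and> continuous_on UNIV \<psi>t \<and>
     (\<exists>K. compact K \<and> K \<subseteq> UNIV \<times> {0<..} \<and> (\<forall>p. p \<notin> K \<longrightarrow> \<psi> p = 0))"

definition bounded_weak_solution ::
  "(real \<Rightarrow> real) \<Rightarrow> (real \<Rightarrow> real) \<Rightarrow> (real \<Rightarrow> real \<Rightarrow> real) \<Rightarrow> bool" where
  "bounded_weak_solution f \<phi> u \<longleftrightarrow>
     (\<lambda>(x, t). u x t) \<in> borel_measurable (lebesgue_on (UNIV \<times> {0<..})) \<and>
     (\<exists>M. \<forall>x. \<forall>t>0. \<bar>u x t\<bar> \<le> M) \<and>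
     (\<forall>\<psi> \<psi>x \<psi>t. test_function \<psi> \<psi>x \<psi>t \<longrightarrow>
        (LINT p:UNIV \<times> {0<..}|lebesgue. (case p of (x, t) \<Rightarrow> u x t * \<psi>t (x, t) + f (u x t) * \<psi>x (x, t))) = 0) \<and>
     (\<forall>x1 x2 :: real.
        ((\<lambda>t. LINT x=x1..x2|lebesgue. (u x t)) \<longlongrightarrow> (LINT x=x1..x2|lebesgue. (\<phi> x))) (at_right 0))"

text \<open>The weak formulation together with the one-sided inequality determines \<open>u\<close> only up to a null
  set of times \<open>t\<close> (a single time slice may be replaced by, say, a constant). The last clause fixes
  the representative that is meant when \<open>u(\<cdot>, t)\<close> is evaluated at an individual \<open>t > 0\<close>: the least
  maximizer of \<open>E\<close>, for every \<open>x\<close> and every \<open>t > 0\<close>. Values of \<open>u\<close> at \<open>t \<le> 0\<close> are irrelevant.\<close>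

definition entropy_solution ::
  "(real \<Rightarrow> real) \<Rightarrow> (real \<Rightarrow> real) \<Rightarrow> (real \<Rightarrow> real \<Rightarrow> real) \<Rightarrow> bool" where
  "entropy_solution f \<phi> u \<longleftrightarrow>
     bounded_weak_solution f \<phi> u \<and>
     (\<forall>t>0. \<forall>x1 x2. x1 < x2 \<longrightarrow> deriv f (u x2 t) - deriv f (u x1 t) \<le> (x2 - x1) / t) \<and>
     (\<forall>x. \<forall>t>0. u x t = Inf (maximizers f \<phi> x t))"

definition mean :: "(real \<Rightarrow> real) \<Rightarrow> real \<Rightarrow> real" where
  "mean g x = 1 / x * (LINT \<xi>=0..x|lebesgue. (g \<xi>))"

end

theory Submission
  imports Defs
begin

text \<open>Substituting \<open>y = x - t * deriv f s\<close> in the integral that defines \<open>E\<close> turns its maximizers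
  into the minimizers of the Lax--Oleinik functional, the maximizers being bounded by the
  essential bound of \<open>\<phi>\<close>. The minimal value \<open>W x\<close> therefore differs from \<open>\<integral>\<^sub>0\<^sup>x \<phi>\<close> by a bounded
  amount, while \<open>u(\<cdot>, t)\<close> is the derivative of \<open>W\<close>. So \<open>\<integral>\<^sub>0\<^sup>x (u(\<xi>, t) - \<phi> \<xi>) d\<xi>\<close> is bounded in \<open>x\<close>
  and the two means differ by \<open>O(1 / x)\<close>. The identity \<open>W' = u\<close> is used in integrated form only, by Riemann sums, since \<open>u\<close>
  may jump at countably many points.\<close>

section \<open>Real analysis: perturbed upper and lower limits, and a criterion for
  constancy\<close>

lemma Limsup_eq_if_diff_tendsto_0:
  fixes a b :: "'a \<Rightarrow> real"
  assumes "((\<lambda>x. a x - b x) \<longlongrightarrow> 0) F"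
  shows "Limsup F (\<lambda>x. ereal (a x)) = Limsup F (\<lambda>x. ereal (b x))"
proof -
  have le: "Limsup F (\<lambda>x. ereal (a x)) \<le> Limsup F (\<lambda>x. ereal (b x))"
    if "((\<lambda>x. a x - b x) \<longlongrightarrow> 0) F" for a b :: "'a \<Rightarrow> real"
    unfolding Limsup_le_iff
  proof (intro allI impI)
    fix y assume "Limsup F (\<lambda>x. ereal (b x)) < y"
    then obtain z where z: "Limsup F (\<lambda>x. ereal (b x)) < z" "z < y"
      using dense by blast
    then obtain r where r: "z = ereal r" by (cases z) auto
    \<comment> \<open>For finite \<open>y\<close> the number itself serves; for infinite
      \<open>y\<close> any real above \<open>r\<close> does.\<close>
    obtain s where s: "r < s" "ereal s \<le> y"
      using z(2) unfolding r by (cases y) (auto intro: that[of "r + 1"])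
    have "\<forall>\<^sub>F x in F. ereal (b x) < ereal r"
      using Limsup_lessD[OF z(1)] r by simp
    moreover have "\<forall>\<^sub>F x in F. a x - b x < s - r"
      using that s(1) by (intro order_tendstoD) auto
    ultimately show "\<forall>\<^sub>F x in F. ereal (a x) < y"
    proof eventually_elim
      case (elim x)
      then have "ereal (a x) < ereal s" by simp
      then show ?case using s(2) by (rule less_le_trans)
    qed
  qed
  have "((\<lambda>x. b x - a x) \<longlongrightarrow> 0) F"
    using tendsto_minus[OF assms] by simp
  then show ?thesis using le assms by (intro antisym) auto
qed

lemma Liminf_eq_if_diff_tendsto_0:
  fixes a b :: "'a \<Rightarrow> real"
  assumes "((\<lambda>x. a x - b x) \<longlongrightarrow> 0) F"
  shows "Liminf F (\<lambda>x. ereal (a x)) = Liminf F (\<lambda>x. ereal (b x))"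
proof -
  have "((\<lambda>x. - a x - - b x) \<longlongrightarrow> 0) F"
    using tendsto_minus[OF assms] by simp
  from Limsup_eq_if_diff_tendsto_0[OF this] show ?thesis
    using ereal_Limsup_uminus[of F "\<lambda>x. ereal (a x)"] ereal_Limsup_uminus[of F "\<lambda>x. ereal (b x)"]
    by simp
qed

text \<open>On a uniform partition the variation terms \<open>u x - u y\<close> telescope.\<close>

lemma constant_if_increment_le_variation:
  fixes D u :: "real \<Rightarrow> real"
  assumes bound: "\<And>x. \<bar>u x\<bar> \<le> M"
    and incr: "\<And>\<epsilon>. \<epsilon> > 0 \<Longrightarrow> \<exists>\<delta>>0. \<forall>x y. x < y \<longrightarrow> y < x + \<delta> \<longrightarrow>
      \<bar>D y - D x\<bar> \<le> (y - x) * (u x - u y + \<epsilon>)"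
    and "a < b"
  shows "D b = D a"
proof -
  have est: "\<bar>D b - D a\<bar> \<le> (b - a) * \<epsilon>" if "\<epsilon> > 0" for \<epsilon>
  proof -
    obtain \<delta> where \<delta>: "\<delta> > 0"
      "\<And>x y. x < y \<Longrightarrow> y < x + \<delta> \<Longrightarrow> \<bar>D y - D x\<bar> \<le> (y - x) * (u x - u y + \<epsilon>)"
      using incr[OF \<open>\<epsilon> > 0\<close>] by blast
    \<comment> \<open>Bounding \<open>u a - u b\<close> by \<open>2 * M\<close> leaves a term of
      order \<open>1 / n\<close>, while the \<open>\<epsilon>\<close> contributions add up to
      \<open>(b - a) * \<epsilon>\<close>.\<close>
    have step: "\<bar>D b - D a\<bar> \<le> (b - a) / real n * (2 * M) + (b - a) * \<epsilon>"
      if n: "n > 0" "(b - a) / real n < \<delta>" for n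
    proof -
      define h where "h = (b - a) / real n"
      define p where "p i = a + real i * h" for i
      have h: "0 < h" "h < \<delta>" using n \<open>a < b\<close> by (auto simp: h_def)
      have pn: "p n = b" "p 0 = a" using n by (auto simp: p_def h_def)
      have "\<bar>D (p (Suc i)) - D (p i)\<bar> \<le> h * (u (p i) - u (p (Suc i)) + \<epsilon>)" for i
        using \<delta>(2)[of "p i" "p (Suc i)"] h by (simp add: p_def algebra_simps)
      then have "\<bar>\<Sum>i<n. D (p (Suc i)) - D (p i)\<bar> \<le> (\<Sum>i<n. h * (u (p i) - u (p (Suc i)) + \<epsilon>))"
        by (intro order_trans[OF sum_abs] sum_mono)
      also have "(\<Sum>i<n. D (p (Suc i)) - D (p i)) = D b - D a"
        using sum_lessThan_telescope[of "\<lambda>i. D (p i)" n] pn by simp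
      also have "(\<Sum>i<n. h * (u (p i) - u (p (Suc i)) + \<epsilon>)) = h * (u a - u b) + n * h * \<epsilon>"
      proof -
        have "(\<Sum>i<n. u (p i) - u (p (Suc i)) + \<epsilon>) = u a - u b + n * \<epsilon>"
          using sum_lessThan_telescope'[of "\<lambda>i. u (p i)" n] pn by (simp add: sum.distrib)
        then have "(\<Sum>i<n. h * (u (p i) - u (p (Suc i)) + \<epsilon>)) = h * (u a - u b + n * \<epsilon>)"
          by (simp only: sum_distrib_left[symmetric])
        then show ?thesis by (simp add: algebra_simps)
      qed
      also have "\<dots> \<le> h * (2 * M) + (b - a) * \<epsilon>"
        using bound[of a] bound[of b] h n by (intro add_mono mult_left_mono) (auto simp: h_def)
      finally show ?thesis by (simp add: h_def)
    qed
    have lim: "(\<lambda>n. (b - a) / real n) \<longlonglongrightarrow> 0"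
      by (rule lim_const_over_n)
    have "\<forall>\<^sub>F n in sequentially. (b - a) / real n < \<delta>"
      using lim \<delta>(1) by (rule order_tendstoD)
    then have "\<forall>\<^sub>F n in sequentially. \<bar>D b - D a\<bar> \<le> (b - a) / real n * (2 * M) + (b - a) * \<epsilon>"
      using eventually_gt_at_top[of 0] by eventually_elim (rule step)
    moreover have "(\<lambda>n. (b - a) / real n * (2 * M) + (b - a) * \<epsilon>) \<longlonglongrightarrow> 0 * (2 * M) + (b - a) * \<epsilon>"
      by (intro tendsto_intros lim)
    ultimately show ?thesis
      using tendsto_lowerbound[where F=sequentially] by fastforce
  qed
  have "\<bar>D b - D a\<bar> \<le> 0"
  proof (rule field_le_epsilon)
    fix e :: real assume "e > 0"
    then show "\<bar>D b - D a\<bar> \<le> 0 + e"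
      using est[of "e / (b - a)"] \<open>a < b\<close> by simp
  qed
  then show ?thesis by simp
qed

section \<open>Oriented Lebesgue integrals over intervals\<close>

text \<open>The oriented integral runs over the open interval, whose end points are null; passing to
  \<open>integral\<close> gives access to splitting and the fundamental theorem.\<close>

lemma interval_lebesgue_integral_lebesgue_eq:
  fixes g :: "real \<Rightarrow> real"
  assumes "\<And>a b. g absolutely_integrable_on {a..b}"
  shows "(LINT x=ereal a..ereal b|lebesgue. g x) =
    (if a \<le> b then integral {a..b} g else - integral {b..a} g)"
proof -
  have "(LINT x:{a<..<b}|lebesgue. g x) = integral {a..b} g" for a b
  proof -
    have "g absolutely_integrable_on {a<..<b}"
      by (rule set_integrable_subset[OF assms[of a b]]) auto
    then show ?thesis
      by (simp add: set_lebesgue_integral_eq_integral integral_open_interval_real)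
  qed
  then show ?thesis by (simp add: interval_lebesgue_integral_def)
qed

lemma interval_lebesgue_integral_lebesgue_diff:
  fixes g :: "real \<Rightarrow> real"
  assumes int: "\<And>a b. g absolutely_integrable_on {a..b}" and "a \<le> b"
  shows "(LINT x=0..ereal b|lebesgue. g x) - (LINT x=0..ereal a|lebesgue. g x) = integral {a..b} g"
proof -
  have "g integrable_on {a..b}" for a b
    using int by (rule set_lebesgue_integral_eq_integral)
  then have comb: "x \<le> y \<Longrightarrow> y \<le> z \<Longrightarrow> integral {x..y} g + integral {y..z} g = integral {x..z} g" for x y z
    by (intro Henstock_Kurzweil_Integration.integral_combine)
  show ?thesis
    using comb[of 0 a b] comb[of a 0 b] comb[of a b 0] \<open>a \<le> b\<close>
    unfolding zero_ereal_def interval_lebesgue_integral_lebesgue_eq[OF int] by auto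
qed

lemma measurable_AE_bounded_absolutely_integrable:
  fixes g :: "real \<Rightarrow> real"
  assumes g: "g \<in> borel_measurable lebesgue" and "AE x in lebesgue. \<bar>g x\<bar> \<le> C"
  shows "g absolutely_integrable_on {a..b}"
    and "a \<le> b \<Longrightarrow> \<bar>integral {a..b} g\<bar> \<le> C * (b - a)"
proof -
  have C: "set_integrable lebesgue {a..b} (\<lambda>x. C)"
    by (simp add: absolutely_integrable_on_const)
  have le: "AE x in lebesgue. norm (indicator {a..b} x *\<^sub>R g x) \<le> norm (indicator {a..b} x *\<^sub>R C)"
    using assms(2) by eventually_elim (auto simp: indicator_def)
  show *: "g absolutely_integrable_on {a..b}"
    unfolding set_integrable_def
  proof (rule Bochner_Integration.integrable_bound[OF _ _ le])
    show "integrable lebesgue (\<lambda>x. indicator {a..b} x *\<^sub>R C)"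
      using C by (simp add: set_integrable_def)
    show "(\<lambda>x. indicator {a..b} x *\<^sub>R g x) \<in> borel_measurable lebesgue"
      by (intro borel_measurable_scaleR borel_measurable_indicator g) auto
  qed
  assume "a \<le> b"
  have n: "set_integrable lebesgue {a..b} (\<lambda>x. norm (g x))"
    using * by (rule set_integrable_norm)
  have "\<bar>integral {a..b} g\<bar> = norm (LINT x:{a..b}|lebesgue. g x)"
    by (simp add: set_lebesgue_integral_eq_integral[OF *])
  also have "\<dots> \<le> (LINT x:{a..b}|lebesgue. norm (g x))"
    using * by (rule set_integral_norm_bound)
  also have "\<dots> \<le> (LINT x:{a..b}|lebesgue. C)"
    by (rule set_integral_mono_AE[OF n C]) (use assms(2) in eventually_elim, auto)
  also have "\<dots> = C * (b - a)"
    using \<open>a \<le> b\<close> by (simp add: set_lebesgue_integral_eq_integral[OF C])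
  finally show "\<bar>integral {a..b} g\<bar> \<le> C * (b - a)" .
qed

section \<open>The convex flux and its strictly increasing derivative\<close>

locale lax_oleinik =
  fixes f \<phi> :: "real \<Rightarrow> real" and C t :: real
  assumes C2: "C2 f"
    and deriv2_nonneg: "\<And>v. deriv (deriv f) v \<ge> 0"
    and deriv2_null: "{v. deriv (deriv f) v = 0} \<in> null_sets lebesgue"
    and \<phi>_measurable: "\<phi> \<in> borel_measurable lebesgue"
    and \<phi>_bound: "AE x in lebesgue. \<bar>\<phi> x\<bar> \<le> C"
    and C_nonneg: "C \<ge> 0"
    and t_pos: "t > 0"
begin

lemma DERIV_f: "(f has_real_derivative deriv f v) (at v within S)"
  using C2 unfolding C2_def
  by (metis DERIV_deriv_iff_real_differentiable has_field_derivative_at_within)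

lemma DERIV_f': "(deriv f has_real_derivative deriv (deriv f) v) (at v within S)"
  using C2 unfolding C2_def
  by (metis DERIV_deriv_iff_real_differentiable has_field_derivative_at_within)

lemma continuous_f: "continuous_on S f"
  using DERIV_f by (rule DERIV_continuous_on)

lemma continuous_f': "continuous_on S (deriv f)"
  using DERIV_f' by (rule DERIV_continuous_on)

lemma continuous_f'': "continuous_on S (deriv (deriv f))"
  using C2 by (auto simp: C2_def intro: continuous_on_subset)

text \<open>A failure of strictness would make \<open>deriv f\<close> constant on a nonempty open
  interval, so \<open>deriv (deriv f)\<close> would vanish on a set of positive measure.\<close>

lemma strict_mono_f': "strict_mono (deriv f)"
proof (rule strict_monoI)
  fix a b :: real assume "a < b"
  have mono: "deriv f x \<le> deriv f y" if "x \<le> y" for x y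
    using that by (rule DERIV_nonneg_imp_nondecreasing) (use DERIV_f' deriv2_nonneg in blast)
  show "deriv f a < deriv f b"
  proof (rule ccontr)
    assume "\<not> deriv f a < deriv f b"
    then have const: "deriv f x = deriv f a" if "x \<in> {a<..<b}" for x
      using mono[of a x] mono[of x b] that by auto
    have "deriv (deriv f) x = 0" if "x \<in> {a<..<b}" for x
    proof -
      have "(deriv f has_real_derivative 0) (at x)"
        by (rule has_field_derivative_transform_within_open[OF DERIV_const[of "deriv f a"], where S = "{a<..<b}"])
          (use that const in auto)
      then show ?thesis using DERIV_f' DERIV_unique by blast
    qed
    then have "{a<..<b} \<in> null_sets lebesgue"
      by (intro null_sets_subset[OF deriv2_null]) auto
    with \<open>a < b\<close> show False by (simp add: null_sets_def)
  qed
qed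

lemma f'_less_iff: "deriv f x < deriv f y \<longleftrightarrow> x < y"
  using strict_mono_f' by (rule strict_mono_less)

lemma f'_le_iff: "deriv f x \<le> deriv f y \<longleftrightarrow> x \<le> y"
  using strict_mono_f' by (rule strict_mono_less_eq)

lemma tangent_le: "deriv f x * (y - x) \<le> f y - f x"
  by (rule f''_imp_f'[of UNIV f "deriv f" "deriv (deriv f)"])
    (use DERIV_f DERIV_f' deriv2_nonneg in auto)

text \<open>Chaining two tangent inequalities through the midpoint \<open>m\<close> gains a strictly
  positive term, because the slopes at \<open>m\<close> and \<open>x\<close> differ.\<close>

lemma tangent_less:
  assumes "x \<noteq> y"
  shows "deriv f x * (y - x) < f y - f x"
proof -
  define m where "m = (x + y) / 2"
  have "deriv f x * (m - x) \<le> f m - f x" "deriv f m * (y - m) \<le> f y - f m"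
    by (rule tangent_le)+
  moreover have "0 < (deriv f m - deriv f x) * (y - m)"
    using assms by (auto simp: zero_less_mult_iff f'_less_iff m_def)
  ultimately show ?thesis by (simp add: algebra_simps)
qed

section \<open>The primitive of the initial datum\<close>

lemma \<phi>_integrable: "\<phi> absolutely_integrable_on {a..b}"
  using \<phi>_measurable \<phi>_bound by (rule measurable_AE_bounded_absolutely_integrable)

definition primitive :: "real \<Rightarrow> real" where
  "primitive x = (LINT \<xi>=0..ereal x|lebesgue. \<phi> \<xi>)"

lemma primitive_diff: "a \<le> b \<Longrightarrow> primitive b - primitive a = integral {a..b} \<phi>"
  unfolding primitive_def using \<phi>_integrable by (rule interval_lebesgue_integral_lebesgue_diff)

lemma primitive_lipschitz: "\<bar>primitive x - primitive y\<bar> \<le> C * \<bar>x - y\<bar>"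
proof (induction x y rule: linorder_wlog)
  case (le a b)
  then have "\<bar>primitive b - primitive a\<bar> \<le> C * (b - a)"
    using measurable_AE_bounded_absolutely_integrable(2)[OF \<phi>_measurable \<phi>_bound]
    by (simp add: primitive_diff)
  then show ?case using le by (simp add: abs_minus_commute)
qed (simp add: abs_minus_commute)

lemma continuous_primitive: "continuous_on S primitive"
proof (rule lipschitz_on_continuous_on)
  show "C-lipschitz_on S primitive"
    using primitive_lipschitz C_nonneg by (auto intro!: lipschitz_onI simp: dist_real_def)
qed

text \<open>In the variable \<open>y = x - t * deriv f v\<close> the cost is \<open>primitive y + t * f\<^sup>* ((x - y) / t)\<close>,
  with \<open>f\<^sup>*\<close> the Legendre transform of \<open>f\<close>.\<close>

definition cost :: "real \<Rightarrow> real \<Rightarrow> real" where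
  "cost x v = primitive (x - t * deriv f v) + t * (v * deriv f v - f v)"

section \<open>From the energy integral to the cost\<close>

text \<open>Substituting \<open>h s\<close>, with Jacobian \<open>t * deriv (deriv f) s\<close>,
  turns the \<open>\<phi>\<close> term into a difference of values of \<open>primitive\<close>; the
  other term is the derivative of \<open>t * (s * deriv f s - f s)\<close>.\<close>

lemma integral_energy_density:
  fixes x :: real
  assumes "a \<le> b"
  defines "g \<equiv> \<lambda>s. deriv (deriv f) s * (\<phi> (x - t * deriv f s) - s)"
  shows "g absolutely_integrable_on {a..b}"
    and "t * integral {a..b} g = cost x a - cost x b"
proof -
  define h where "h s = x - t * deriv f s" for s
  have h_der: "(h has_real_derivative - t * deriv (deriv f) s) (at s within {a..b})" for s
    unfolding h_def by (auto intro!: derivative_eq_intros DERIV_f')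
  have h_anti: "h x \<le> h y \<longleftrightarrow> y \<le> x" for x y
    using t_pos by (simp add: h_def f'_le_iff)
  \<comment> \<open>Injectivity rests on strict monotonicity of \<open>deriv f\<close>, even though
    the Jacobian may vanish on a null set.\<close>
  have inj: "inj_on h {a..b}"
    by (rule inj_onI) (simp add: h_anti order.antisym order.eq_iff[of "h _"])
  have cont: "continuous_on {a..b} h"
    unfolding h_def by (intro continuous_intros continuous_f')
  have img: "h ` {a..b} = {h b..h a}"
  proof
    show "h ` {a..b} \<subseteq> {h b..h a}" using h_anti by auto
    show "{h b..h a} \<subseteq> h ` {a..b}"
      using IVT2'[of h b _ a] cont \<open>a \<le> b\<close> by fastforce
  qed
  have "(\<lambda>s. \<bar>- t * deriv (deriv f) s\<bar> * \<phi> (h s)) absolutely_integrable_on {a..b} \<and>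
      integral {a..b} (\<lambda>s. \<bar>- t * deriv (deriv f) s\<bar> * \<phi> (h s)) = integral {h b..h a} \<phi>"
    using has_absolute_integral_change_of_variables_1'[OF _ h_der inj, of \<phi>] \<phi>_integrable
    unfolding img by simp
  moreover have "\<bar>- t * deriv (deriv f) s\<bar> = t * deriv (deriv f) s" for s
    using deriv2_nonneg t_pos by (simp add: abs_mult)
  ultimately have 1: "(\<lambda>s. t * deriv (deriv f) s * \<phi> (h s)) absolutely_integrable_on {a..b}"
    "integral {a..b} (\<lambda>s. t * deriv (deriv f) s * \<phi> (h s)) = primitive (h a) - primitive (h b)"
    using primitive_diff[of "h b" "h a"] h_anti \<open>a \<le> b\<close> by auto
  have 2: "(\<lambda>s. t * deriv (deriv f) s * s) absolutely_integrable_on {a..b}"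
    by (intro absolutely_integrable_continuous_real continuous_intros continuous_f'')
  have "((\<lambda>s. t * (s * deriv f s - f s)) has_vector_derivative t * deriv (deriv f) s * s)
      (at s within {a..b})" for s
    unfolding has_real_derivative_iff_has_vector_derivative[symmetric]
    by (auto intro!: derivative_eq_intros DERIV_f DERIV_f')
  then have 3: "integral {a..b} (\<lambda>s. t * deriv (deriv f) s * s) =
      t * (b * deriv f b - f b) - t * (a * deriv f a - f a)"
    by (intro integral_unique fundamental_theorem_of_calculus \<open>a \<le> b\<close>)
  have tg: "(\<lambda>s. t * g s) = (\<lambda>s. t * deriv (deriv f) s * \<phi> (h s) - t * deriv (deriv f) s * s)"
    by (auto simp: g_def h_def algebra_simps)
  have "(\<lambda>s. t * g s) absolutely_integrable_on {a..b}"
    unfolding tg using 1(1) 2 by (rule set_integral_diff)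
  then show "g absolutely_integrable_on {a..b}"
    using t_pos by simp
  have "t * integral {a..b} g = integral {a..b} (\<lambda>s. t * g s)"
    by simp
  also have "\<dots> = integral {a..b} (\<lambda>s. t * deriv (deriv f) s * \<phi> (h s)) -
      integral {a..b} (\<lambda>s. t * deriv (deriv f) s * s)"
    unfolding tg using 1(1) 2 by (intro Henstock_Kurzweil_Integration.integral_diff
        set_lebesgue_integral_eq_integral)
  finally show "t * integral {a..b} g = cost x a - cost x b"
    unfolding 1(2) 3 by (simp add: cost_def h_def)
qed

text \<open>Since \<open>cost x 0\<close> does not depend on \<open>v\<close>, maximizing the energy
  amounts to minimizing \<open>cost x\<close>.\<close>

lemma E_fun_eq: "E_fun f \<phi> x t v = cost x 0 - cost x v"
proof -
  let ?g = "\<lambda>s. deriv (deriv f) s * (\<phi> (x - t * deriv f s) - s)"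
  have int: "?g absolutely_integrable_on {a..b}" for a b
    using integral_energy_density(1)[of a b x] by (cases "a \<le> b") auto
  show ?thesis
    using integral_energy_density(2)[of 0 v x] integral_energy_density(2)[of v 0 x]
    unfolding E_fun_def zero_ereal_def interval_lebesgue_integral_lebesgue_eq[OF int] by auto
qed

lemma maximizers_eq: "maximizers f \<phi> x t = {v. \<forall>w. cost x v \<le> cost x w}"
  by (simp add: maximizers_def E_fun_eq)

lemma continuous_cost: "continuous_on S (cost x)"
  unfolding cost_def
  by (intro continuous_intros continuous_f continuous_f' continuous_on_compose2[OF continuous_primitive[of UNIV]]) auto

section \<open>Confinement of the minimizers to a compact interval\<close>

text \<open>Beyond \<open>C\<close> the term \<open>t * (v * deriv f v - f v)\<close> grows by more
  than \<open>C\<close> times the shift of the foot, and \<open>primitive\<close>, being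
  \<open>C\<close>-Lipschitz, cannot offset that.\<close>

lemma cost_less_above:
  assumes "C < v"
  shows "cost x C < cost x v"
proof -
  have "C * (deriv f v - deriv f C) < (v * deriv f v - f v) - (C * deriv f C - f C)"
    using tangent_less[of v C] assms by (simp add: algebra_simps)
  then have "t * (C * (deriv f v - deriv f C)) < t * ((v * deriv f v - f v) - (C * deriv f C - f C))"
    using t_pos by simp
  moreover have "\<bar>primitive (x - t * deriv f v) - primitive (x - t * deriv f C)\<bar> \<le>
      C * \<bar>(x - t * deriv f v) - (x - t * deriv f C)\<bar>"
    by (rule primitive_lipschitz)
  moreover have "\<bar>(x - t * deriv f v) - (x - t * deriv f C)\<bar> = t * (deriv f v - deriv f C)"
    using t_pos f'_le_iff[of C v] assms by (simp add: abs_if algebra_simps mult_le_cancel_left)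
  ultimately show ?thesis
    by (simp add: cost_def algebra_simps)
qed

lemma cost_less_below:
  assumes "v < - C"
  shows "cost x (- C) < cost x v"
proof -
  have "C * (deriv f (- C) - deriv f v) < (v * deriv f v - f v) - ((- C) * deriv f (- C) - f (- C))"
    using tangent_less[of v "- C"] assms by (simp add: algebra_simps)
  then have "t * (C * (deriv f (- C) - deriv f v)) <
      t * ((v * deriv f v - f v) - ((- C) * deriv f (- C) - f (- C)))"
    using t_pos by simp
  moreover have "\<bar>primitive (x - t * deriv f v) - primitive (x - t * deriv f (- C))\<bar> \<le>
      C * \<bar>(x - t * deriv f v) - (x - t * deriv f (- C))\<bar>"
    by (rule primitive_lipschitz)
  moreover have "\<bar>(x - t * deriv f v) - (x - t * deriv f (- C))\<bar> = t * (deriv f (- C) - deriv f v)"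
    using t_pos f'_le_iff[of v "- C"] assms by (simp add: abs_if algebra_simps mult_le_cancel_left)
  ultimately show ?thesis
    by (simp add: cost_def algebra_simps)
qed

definition least_maximizer :: "real \<Rightarrow> real" where
  "least_maximizer x = Inf (maximizers f \<phi> x t)"

text \<open>A minimum of \<open>cost x\<close> over \<open>{-C..C}\<close> exists by compactness and
  is global by the two preceding estimates. The minimizers form a closed set inside that interval,
  so their infimum is attained.\<close>

lemma least_maximizer: "least_maximizer x \<in> maximizers f \<phi> x t"
  and least_maximizer_bound: "\<bar>least_maximizer x\<bar> \<le> C"
proof -
  let ?U = "maximizers f \<phi> x t"
  obtain v where v: "v \<in> {-C..C}" "\<And>w. w \<in> {-C..C} \<Longrightarrow> cost x v \<le> cost x w"
    using continuous_attains_inf[OF _ _ continuous_cost, of "{-C..C}" x] C_nonneg by auto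
  \<comment> \<open>A point outside the interval costs more than the nearer end point, hence more
    than \<open>v\<close>.\<close>
  have "cost x v \<le> cost x w" for w
    using v(2)[of w] v(2)[of C] v(2)[of "- C"] cost_less_above[of w x] cost_less_below[of w x] C_nonneg
    by (cases "C < w"; cases "w < - C") force+
  then have ne: "?U \<noteq> {}" by (auto simp: maximizers_eq)
  have "closed ?U"
    unfolding maximizers_eq
    by (intro closed_Collect_all closed_Collect_le continuous_cost continuous_on_const)
  have sub: "?U \<subseteq> {-C..C}"
    using cost_less_above[of _ x] cost_less_below[of _ x] unfolding maximizers_eq
    by (force simp: not_less[symmetric])
  then have bdd: "bdd_below ?U" by (rule bdd_below_mono[OF bdd_below_Icc])
  show *: "least_maximizer x \<in> ?U"
    unfolding least_maximizer_def by (rule closed_contains_Inf[OF ne bdd \<open>closed ?U\<close>])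
  then show "\<bar>least_maximizer x\<bar> \<le> C" using sub by force
qed

section \<open>The Lax-Oleinik value function\<close>

text \<open>The minimal value \<open>W\<close>, a Hopf-Lax formula with initial datum
  \<open>primitive\<close>.\<close>

definition value_fun :: "real \<Rightarrow> real" where
  "value_fun x = cost x (least_maximizer x)"

lemma value_fun_le: "value_fun x \<le> cost x v"
  using least_maximizer[of x] by (simp add: value_fun_def maximizers_eq)

text \<open>With the minimizer confined to \<open>{-C..C}\<close>, continuity of \<open>f\<close>
  and \<open>deriv f\<close> bounds both the distance from the foot to \<open>x\<close> and the
  Legendre term, uniformly in \<open>x\<close>.\<close>

lemma value_fun_close_to_primitive: "\<exists>K. \<forall>x. \<bar>value_fun x - primitive x\<bar> \<le> K"
proof -
  have "\<exists>B. \<forall>v\<in>{-C..C}. C * \<bar>t * deriv f v\<bar> + \<bar>t * (v * deriv f v - f v)\<bar> \<le> B"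
    using continuous_attains_sup[of "{-C..C}" "\<lambda>v. C * \<bar>t * deriv f v\<bar> + \<bar>t * (v * deriv f v - f v)\<bar>"]
      C_nonneg by (force intro!: continuous_intros continuous_f continuous_f')
  then obtain B where
    B: "\<And>v. \<bar>v\<bar> \<le> C \<Longrightarrow> C * \<bar>t * deriv f v\<bar> + \<bar>t * (v * deriv f v - f v)\<bar> \<le> B"
    by (fastforce simp: abs_le_iff)
  have "\<bar>value_fun x - primitive x\<bar> \<le> B" for x
    using B[OF least_maximizer_bound[of x]]
      primitive_lipschitz[of "x - t * deriv f (least_maximizer x)" x]
    by (simp add: value_fun_def cost_def)
  then show ?thesis by blast
qed

text \<open>Moving the end point from \<open>x\<close> to \<open>y\<close> while keeping the foot \<open>x - t * deriv f u\<close> of the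
  characteristic fixed turns the optimal \<open>u\<close> into \<open>v\<close>.\<close>

lemma value_fun_diff_le:
  assumes "deriv f v = deriv f (least_maximizer x) + (y - x) / t"
  shows "value_fun y - value_fun x \<le> v * (y - x)"
proof -
  define u where "u = least_maximizer x"
  have foot: "y - t * deriv f v = x - t * deriv f u"
    using assms t_pos by (simp add: u_def field_simps)
  have "value_fun y - value_fun x \<le> cost y v - cost x u"
    using value_fun_le[of y v] by (simp add: value_fun_def u_def)
  also have "\<dots> = t * ((v * deriv f v - f v) - (u * deriv f u - f u))"
    unfolding cost_def foot by (simp add: algebra_simps)
  \<comment> \<open>This is the tangent inequality at \<open>u\<close>, rearranged; it says that
    \<open>v\<close> is a subgradient of the Legendre transform at \<open>deriv f v\<close>.\<close>
  also have "\<dots> \<le> t * (v * (deriv f v - deriv f u))"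
    using tangent_le[of u v] t_pos by (intro mult_left_mono) (auto simp: algebra_simps)
  also have "\<dots> = v * (y - x)"
  proof -
    have "t * (deriv f v - deriv f u) = y - x"
      using foot by (simp add: algebra_simps)
    then show ?thesis by (metis mult.left_commute)
  qed
  finally show ?thesis .
qed

text \<open>A uniform modulus for the inverse of \<open>deriv f\<close>: small increments of
  \<open>deriv f\<close> force small shifts of the argument. The witness is the minimum of a
  positive continuous function over a compact interval.\<close>

lemma f'_uniform_increase:
  assumes "\<epsilon> > 0"
  obtains \<delta> where "\<delta> > 0" "\<And>v. \<bar>v\<bar> \<le> M \<Longrightarrow> deriv f v + \<delta> \<le> deriv f (v + \<epsilon>)"
proof (cases "M \<ge> 0")
  case True
  have "\<exists>v\<in>{-M..M}. \<forall>w\<in>{-M..M}. deriv f (v + \<epsilon>) - deriv f v \<le> deriv f (w + \<epsilon>) - deriv f w"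
    using True by (intro continuous_attains_inf continuous_intros continuous_f'
        continuous_on_compose2[OF continuous_f'[of UNIV]]) auto
  then obtain v where v: "\<And>w. \<bar>w\<bar> \<le> M \<Longrightarrow> deriv f (v + \<epsilon>) - deriv f v \<le> deriv f (w + \<epsilon>) - deriv f w"
    by (fastforce simp: abs_le_iff)
  show ?thesis
    by (rule that[of "deriv f (v + \<epsilon>) - deriv f v"]) (use assms v f'_less_iff in fastforce)+
next
  case False
  then show ?thesis by (intro that[of 1]) auto
qed

text \<open>Supplies the \<open>v\<close> of \<open>value_fun_diff_le\<close>. As
  \<open>deriv f\<close> may fail to be onto, existence is localized between two known
  values.\<close>

lemma f'_intermediate:
  assumes "deriv f a \<le> c" "c \<le> deriv f b"
  obtains v where "deriv f v = c" "a \<le> v" "v \<le> b"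
proof -
  have "a \<le> b" using assms f'_le_iff by (metis order.trans)
  then show ?thesis
    using IVT'[of "deriv f" a c b] assms continuous_f' that by blast
qed

end

section \<open>The value function as a primitive of the least maximizer\<close>

locale entropy_lax_oleinik = lax_oleinik +
  assumes one_sided: "\<And>x y. x < y \<Longrightarrow>
    deriv f (least_maximizer y) - deriv f (least_maximizer x) \<le> (y - x) / t"
begin

text \<open>The one-sided inequality makes \<open>x / t - deriv f (least_maximizer x)\<close>
  monotone, hence Borel; sublevel sets transfer through the strictly increasing
  \<open>deriv f\<close>.\<close>

lemma least_maximizer_measurable: "least_maximizer \<in> borel_measurable borel"
proof -
  have "mono (\<lambda>x. x / t - deriv f (least_maximizer x))"
  proof (rule monoI)
    fix x y :: real assume "x \<le> y"
    then show "x / t - deriv f (least_maximizer x) \<le> y / t - deriv f (least_maximizer y)"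
      using one_sided[of x y] by (cases "x = y") (auto simp: diff_divide_distrib)
  qed
  then have "(\<lambda>x. x / t - (x / t - deriv f (least_maximizer x))) \<in> borel_measurable borel"
    by (intro borel_measurable_diff borel_measurable_mono[of "\<lambda>x. x / t - _ x"]) measurable
  then have [measurable]: "(\<lambda>x. deriv f (least_maximizer x)) \<in> borel_measurable borel"
    by simp
  have "{x \<in> space borel. least_maximizer x \<le> c} = {x \<in> space borel. deriv f (least_maximizer x) \<le> deriv f c}" for c
    by (simp add: f'_le_iff)
  then show ?thesis
    unfolding borel_measurable_iff_le by simp
qed

lemma least_maximizer_integrable: "least_maximizer absolutely_integrable_on {a..b}"
  by (rule measurable_AE_bounded_absolutely_integrable[of _ C])
    (use least_maximizer_bound least_maximizer_measurable in \<open>auto intro: measurable_completion\<close>)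

text \<open>Both the increment of \<open>value_fun\<close> and the integral lie between
  \<open>y - x\<close> times the value at \<open>y\<close> lowered by \<open>e\<close> and
  \<open>y - x\<close> times the value at \<open>x\<close> raised by \<open>e\<close>.\<close>

lemma value_fun_increment:
  assumes "\<epsilon> > 0"
  shows "\<exists>\<delta>>0. \<forall>x y. x < y \<longrightarrow> y < x + \<delta> \<longrightarrow>
    \<bar>(value_fun y - value_fun x) - integral {x..y} least_maximizer\<bar> \<le>
      (y - x) * (least_maximizer x - least_maximizer y + \<epsilon>)"
proof -
  let ?u = least_maximizer
  \<comment> \<open>Halved because one error \<open>e\<close> enters at each end.\<close>
  define e where "e = \<epsilon> / 2"
  have "e > 0" using assms by (simp add: e_def)
  \<comment> \<open>The radius \<open>C + e\<close> covers the maximizers as well as the shifted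
    point \<open>?u y - e\<close>.\<close>
  then obtain d where d: "d > 0" "\<And>v. \<bar>v\<bar> \<le> C + e \<Longrightarrow> deriv f v + d \<le> deriv f (v + e)"
    by (rule f'_uniform_increase[of e "C + e"]) blast
  \<comment> \<open>The width \<open>t * d\<close> keeps the change \<open>(y - x) / t\<close> of
    \<open>deriv f\<close> within \<open>d\<close>.\<close>
  have "\<bar>(value_fun y - value_fun x) - integral {x..y} ?u\<bar> \<le> (y - x) * (?u x - ?u y + \<epsilon>)"
    if xy: "x < y" "y < x + t * d" for x y
  proof -
    have step: "(y - x) / t \<le> d" "0 \<le> (y - x) / t"
      using xy t_pos by (simp_all add: field_simps)
    have up: "deriv f (?u z) + d \<le> deriv f (?u z + e)" for z
      using d(2)[of "?u z"] least_maximizer_bound[of z] \<open>e > 0\<close> by simp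
    have down: "deriv f (?u y - e) + d \<le> deriv f (?u y)"
      using d(2)[of "?u y - e"] least_maximizer_bound[of y] \<open>e > 0\<close> by simp
    have "value_fun y - value_fun x \<le> (?u x + e) * (y - x)"
    proof -
      obtain v where v: "deriv f v = deriv f (?u x) + (y - x) / t" "v \<le> ?u x + e"
        using f'_intermediate[of "?u x" "deriv f (?u x) + (y - x) / t" "?u x + e"] step up[of x] by auto
      have "v * (y - x) \<le> (?u x + e) * (y - x)"
        using v(2) xy by (intro mult_right_mono) auto
      with value_fun_diff_le[OF v(1)] show ?thesis by simp
    qed
    \<comment> \<open>The same estimate run backwards, with \<open>y\<close> as base point and
      \<open>x\<close> as target; the sign change turns the upper bound into a lower one.\<close>
    moreover have "value_fun y - value_fun x \<ge> (?u y - e) * (y - x)"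
    proof -
      obtain v where v: "deriv f v = deriv f (?u y) - (y - x) / t" "?u y - e \<le> v"
        using f'_intermediate[of "?u y - e" "deriv f (?u y) - (y - x) / t" "?u y"] step down by auto
      have "(?u y - e) * (y - x) \<le> v * (y - x)"
        using v(2) xy by (intro mult_right_mono) auto
      moreover have "deriv f v = deriv f (?u y) + (x - y) / t"
        using v(1) by (simp add: diff_divide_distrib)
      ultimately show ?thesis using value_fun_diff_le[of v y x] by (simp add: algebra_simps)
    qed
    moreover
    have u_int: "?u integrable_on {x..y}"
      using least_maximizer_integrable by (rule set_lebesgue_integral_eq_integral)
    have "integral {x..y} ?u \<le> integral {x..y} (\<lambda>_. ?u x + e)"
    proof (rule integral_le[OF u_int integrable_const_ivl])
      fix z assume z: "z \<in> {x..y}"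
      \<comment> \<open>The one-sided inequality limits the rise of \<open>deriv f\<close> along
        \<open>?u\<close> to \<open>d\<close>, which \<open>up\<close> converts into a rise of
        \<open>?u\<close> by at most \<open>e\<close>.\<close>
      have "deriv f (?u z) - deriv f (?u x) \<le> (z - x) / t"
        using one_sided[of x z] z by (cases "x = z") auto
      also have "\<dots> \<le> (y - x) / t" using z t_pos by (intro divide_right_mono) auto
      finally show "?u z \<le> ?u x + e"
        using step up[of x] f'_le_iff[of "?u z" "?u x + e"] by linarith
    qed
    then have "integral {x..y} ?u \<le> (?u x + e) * (y - x)"
      using xy by (simp add: mult.commute)
    moreover have "integral {x..y} (\<lambda>_. ?u y - e) \<le> integral {x..y} ?u"
    proof (rule integral_le[OF integrable_const_ivl u_int])
      fix z assume z: "z \<in> {x..y}"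
      have "deriv f (?u y) - deriv f (?u z) \<le> (y - z) / t"
        using one_sided[of z y] z by (cases "y = z") auto
      also have "\<dots> \<le> (y - x) / t" using z t_pos by (intro divide_right_mono) auto
      finally have "?u y \<le> ?u z + e"
        using step up[of z] f'_le_iff[of "?u y" "?u z + e"] by linarith
      then show "?u y - e \<le> ?u z" by simp
    qed
    then have "(?u y - e) * (y - x) \<le> integral {x..y} ?u"
      using xy by (simp add: mult.commute)
    ultimately have "\<bar>(value_fun y - value_fun x) - integral {x..y} ?u\<bar> \<le>
        (?u x + e) * (y - x) - (?u y - e) * (y - x)"
      by linarith
    also have "\<dots> = (y - x) * (?u x - ?u y + \<epsilon>)"
      by (simp add: e_def field_simps)
    finally show ?thesis .
  qed
  then show ?thesis using d(1) t_pos by (intro exI[of _ "t * d"]) auto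
qed

text \<open>The discrepancy \<open>D\<close> between the two sides is constant by the Riemann-sum
  criterion, fed with \<open>value_fun_increment\<close>.\<close>

lemma integral_least_maximizer:
  "(LINT \<xi>=0..ereal x|lebesgue. least_maximizer \<xi>) = value_fun x - value_fun 0"
proof -
  define D where "D x = value_fun x - (LINT \<xi>=0..ereal x|lebesgue. least_maximizer \<xi>)" for x
  have D_diff: "D y - D x = (value_fun y - value_fun x) - integral {x..y} least_maximizer" if "x < y" for x y
    using interval_lebesgue_integral_lebesgue_diff[OF least_maximizer_integrable, of x y] that
    by (simp add: D_def)
  have const: "D b = D a" if "a < b" for a b
  proof (rule constant_if_increment_le_variation[OF least_maximizer_bound _ that])
    fix \<epsilon> :: real assume "\<epsilon> > 0"
    from value_fun_increment[OF this] obtain \<delta> where "\<delta> > 0" and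
      \<delta>: "\<And>x y. x < y \<Longrightarrow> y < x + \<delta> \<Longrightarrow>
        \<bar>(value_fun y - value_fun x) - integral {x..y} least_maximizer\<bar> \<le>
          (y - x) * (least_maximizer x - least_maximizer y + \<epsilon>)"
      by blast
    then show "\<exists>\<delta>>0. \<forall>x y. x < y \<longrightarrow> y < x + \<delta> \<longrightarrow>
        \<bar>D y - D x\<bar> \<le> (y - x) * (least_maximizer x - least_maximizer y + \<epsilon>)"
      by (intro exI[of _ \<delta>]) (auto simp: D_diff)
  qed
  have "D x = D 0"
    using const[of x 0] const[of 0 x] by (cases x "0 :: real" rule: linorder_cases) auto
  moreover have "D 0 = value_fun 0"
    by (simp add: D_def interval_lebesgue_integral_lebesgue_eq[OF least_maximizer_integrable] zero_ereal_def)
  ultimately show ?thesis by (simp add: D_def)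
qed

section \<open>Comparison of the means\<close>

lemma mean_diff_bound: "\<exists>K. \<forall>x. \<bar>mean least_maximizer x - mean \<phi> x\<bar> \<le> K / \<bar>x\<bar>"
proof -
  obtain K where K: "\<And>x. \<bar>value_fun x - primitive x\<bar> \<le> K"
    using value_fun_close_to_primitive by blast
  \<comment> \<open>At \<open>x = 0\<close> both sides are 0, because division by zero yields
    0.\<close>
  have "\<bar>mean least_maximizer x - mean \<phi> x\<bar> \<le> (K + \<bar>value_fun 0\<bar>) / \<bar>x\<bar>" for x
  proof -
    have "mean least_maximizer x - mean \<phi> x = (value_fun x - value_fun 0 - primitive x) / x"
      by (simp add: mean_def integral_least_maximizer primitive_def diff_divide_distrib)
    also have "\<bar>\<dots>\<bar> \<le> (K + \<bar>value_fun 0\<bar>) / \<bar>x\<bar>"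
      using K[of x] by (auto simp: abs_divide intro!: divide_right_mono)
    finally show ?thesis .
  qed
  then show ?thesis by blast
qed

text \<open>The filter \<open>at_infinity\<close> treats both ends of the line at once.\<close>

lemma mean_diff_tendsto_0:
  assumes "filterlim (\<lambda>x. x) at_infinity F"
  shows "((\<lambda>x. mean least_maximizer x - mean \<phi> x) \<longlongrightarrow> 0) F"
proof -
  obtain K where K: "\<And>x. \<bar>mean least_maximizer x - mean \<phi> x\<bar> \<le> K / \<bar>x\<bar>"
    using mean_diff_bound by blast
  have "((\<lambda>x. K / x) \<longlongrightarrow> 0) F"
    using tendsto_const assms by (rule tendsto_divide_0)
  then have "((\<lambda>x. \<bar>K / x\<bar>) \<longlongrightarrow> 0) F"
    by (rule tendsto_rabs_zero)
  then show ?thesis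
    by (rule Lim_null_comparison[rotated])
      (auto simp: abs_divide intro!: always_eventually order_trans[OF K] divide_right_mono)
qed

end

theorem theorem6p2:
  fixes f \<phi> :: "real \<Rightarrow> real" and u :: "real \<Rightarrow> real \<Rightarrow> real"
    and ul_sup ul_inf ur_sup ur_inf :: ereal and t :: real
  assumes "C2 f"
    and "\<forall>v. deriv (deriv f) v \<ge> 0"
    and "{v. deriv (deriv f) v = 0} \<in> null_sets lebesgue"
    and "L_infinity \<phi>"
    and "ul_sup = Limsup at_bot (\<lambda>x. ereal (mean \<phi> x))"
    and "ul_inf = Liminf at_bot (\<lambda>x. ereal (mean \<phi> x))"
    and "ur_sup = Limsup at_top (\<lambda>x. ereal (mean \<phi> x))"
    and "ur_inf = Liminf at_top (\<lambda>x. ereal (mean \<phi> x))"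
    and "entropy_solution f \<phi> u"
    and "t > 0"
  shows "Limsup at_bot (\<lambda>x. ereal (mean (\<lambda>\<xi>. u \<xi> t) x)) = ul_sup \<and>
         Liminf at_bot (\<lambda>x. ereal (mean (\<lambda>\<xi>. u \<xi> t) x)) = ul_inf \<and>
         Limsup at_top (\<lambda>x. ereal (mean (\<lambda>\<xi>. u \<xi> t) x)) = ur_sup \<and>
         Liminf at_top (\<lambda>x. ereal (mean (\<lambda>\<xi>. u \<xi> t) x)) = ur_inf"
proof -
  obtain C where "AE x in lebesgue. \<bar>\<phi> x\<bar> \<le> C"
    using assms(4) by (auto simp: L_infinity_def)
  \<comment> \<open>Taking \<open>max C 0\<close> secures the nonnegative bound that the locale asks
    for.\<close>
  then have C: "AE x in lebesgue. \<bar>\<phi> x\<bar> \<le> max C 0"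
    by eventually_elim auto
  interpret lax_oleinik f \<phi> "max C 0" t
    using assms C by unfold_locales (auto simp: L_infinity_def)
  \<comment> \<open>The pointwise identification of the time slice carries the one-sided inequality
    over to \<open>least_maximizer\<close>.\<close>
  have u: "u x t = least_maximizer x" for x
    using assms(9,10) by (simp add: entropy_solution_def least_maximizer_def)
  interpret entropy_lax_oleinik f \<phi> "max C 0" t
    using assms(9,10) by unfold_locales (auto simp: entropy_solution_def simp flip: u)
  have "((\<lambda>x. mean (\<lambda>\<xi>. u \<xi> t) x - mean \<phi> x) \<longlongrightarrow> 0) at_bot"
    "((\<lambda>x. mean (\<lambda>\<xi>. u \<xi> t) x - mean \<phi> x) \<longlongrightarrow> 0) at_top"
    unfolding u
    by (intro mean_diff_tendsto_0 filterlim_mono[OF filterlim_ident _ order.refl]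
        at_bot_le_at_infinity at_top_le_at_infinity)+
  then show ?thesis
    unfolding assms(5-8)
    by (intro conjI Limsup_eq_if_diff_tendsto_0 Liminf_eq_if_diff_tendsto_0)
qed

end
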